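(* Let $X$ be an Archimedean vector lattice. Then $X$ has net catching elements if and only if $X$ is finite dimensional.
   Context: A partially ordered vector space is a real vector space $X$ with a partial order $\leq$ such that $x\leq y$ implies $x+z\leq y+z$ and $\lambda x\leq\lambda y$ for all $z\in X$ and real $\lambda\geq 0$. It is a vector lattice if every non-empty finite subset has an infimum and a supremum. It is Archimedean if for all $x,y\in X$ with $nx\leq y$ for all $n\in\mathbb{N}$ one has $x\leq 0$. For a net $(x_\alpha)_{\alpha\in A}$ in $X$ we write $x_\alpha\downarrow 0$ if the net is decreasing ($\alpha\leq\beta$ implies $x_\beta\leq x_\alpha$) and $\inf_{\alpha\in A} x_\alpha=0$. An element $y\in X$ is called net catching if for every net $(x_\alpha)_{\alpha\in A}$ in $X$ with $x_\alpha\downarrow 0$ there is $\alpha\in A$ with $x_\alpha\leq y$. *)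

theory Defs
  imports Complex_Main "HOL-Library.Lub_Glb"
begin

definition directed_index :: "'i set \<Rightarrow> ('i \<times> 'i) set \<Rightarrow> bool" where
  "directed_index A r \<longleftrightarrow>
     A \<noteq> {} \<and> preorder_on A r \<and> (\<forall>\<alpha>\<in>A. \<forall>\<beta>\<in>A. \<exists>\<gamma>\<in>A. (\<alpha>, \<gamma>) \<in> r \<and> (\<beta>, \<gamma>) \<in> r)"

text \<open>
  A net is a family \<open>x\<close> restricted to a directed index set \<open>A\<close>, where \<open>(\<alpha>, \<beta>) \<in> r\<close> stands for
  \<open>\<alpha> \<le> \<beta>\<close>.  The infimum is taken in the whole space.
\<close>

definition net_decreases_to_zero ::
  "'i set \<Rightarrow> ('i \<times> 'i) set \<Rightarrow> ('i \<Rightarrow> 'a :: ordered_real_vector) \<Rightarrow> bool" where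
  "net_decreases_to_zero A r x \<longleftrightarrow>
     directed_index A r \<and> (\<forall>\<alpha> \<beta>. (\<alpha>, \<beta>) \<in> r \<longrightarrow> x \<beta> \<le> x \<alpha>) \<and> isGlb UNIV (x ` A) 0"

text \<open>
  A formula cannot quantify over all types of indices, so the definition uses nets whose indices
  are drawn from the type of the space itself.  By \<open>net_catching_any_index\<close> below this
  is no restriction.
\<close>

definition net_catching :: "'a :: ordered_real_vector \<Rightarrow> bool" where
  "net_catching y \<longleftrightarrow>
     (\<forall>(A :: 'a set) r x. net_decreases_to_zero A r x \<longrightarrow> (\<exists>\<alpha>\<in>A. x \<alpha> \<le> y))"

lemma net_catching_any_index:
  fixes y :: "'a :: ordered_real_vector" and A :: "'i set"
  assumes "net_catching y" and net: "net_decreases_to_zero A r x"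
  shows "\<exists>\<alpha>\<in>A. x \<alpha> \<le> y"
proof -
  define s where "s = {(u, v). u \<in> x ` A \<and> v \<in> x ` A \<and> v \<le> u}"
  have dir: "A \<noteq> {}" "\<And>\<alpha> \<beta>. \<alpha> \<in> A \<Longrightarrow> \<beta> \<in> A \<Longrightarrow> \<exists>\<gamma>\<in>A. (\<alpha>, \<gamma>) \<in> r \<and> (\<beta>, \<gamma>) \<in> r"
    and dec: "\<And>\<alpha> \<beta>. (\<alpha>, \<beta>) \<in> r \<Longrightarrow> x \<beta> \<le> x \<alpha>" and glb: "isGlb UNIV (x ` A) 0"
    using net by (auto simp: net_decreases_to_zero_def directed_index_def)
  have "preorder_on (x ` A) s"
    by (auto simp: preorder_on_def refl_on_def trans_def s_def)
  moreover have "\<exists>w\<in>x ` A. (u, w) \<in> s \<and> (v, w) \<in> s" if "u \<in> x ` A" "v \<in> x ` A" for u v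
  proof -
    from that obtain \<alpha> \<beta> where ab: "\<alpha> \<in> A" "u = x \<alpha>" "\<beta> \<in> A" "v = x \<beta>"
      by blast
    then obtain \<gamma> where "\<gamma> \<in> A" "(\<alpha>, \<gamma>) \<in> r" "(\<beta>, \<gamma>) \<in> r"
      using dir by blast
    then show ?thesis
      using ab dec by (auto simp: s_def)
  qed
  ultimately have "directed_index (x ` A) s"
    using dir(1) by (auto simp: directed_index_def)
  then have "net_decreases_to_zero (x ` A) s (\<lambda>u. u)"
    using glb by (auto simp: net_decreases_to_zero_def s_def)
  then have "\<exists>u\<in>x ` A. u \<le> y"
    using assms(1) unfolding net_catching_def by blast
  then show ?thesis
    by blast
qed

text \<open>
  Here \<open>n\<close> may be \<open>0\<close>; in a vector lattice this makes no difference, by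
  \<open>archimedean_ordered_iff_pos\<close>.
\<close>

definition archimedean_ordered :: "'a :: ordered_real_vector itself \<Rightarrow> bool" where
  "archimedean_ordered _ \<longleftrightarrow>
     (\<forall>x y :: 'a. (\<forall>n::nat. real n *\<^sub>R x \<le> y) \<longrightarrow> x \<le> 0)"

lemma archimedean_ordered_iff_pos:
  "archimedean_ordered TYPE('a :: {ordered_real_vector, lattice}) \<longleftrightarrow>
     (\<forall>x y :: 'a. (\<forall>n::nat. n \<ge> 1 \<longrightarrow> real n *\<^sub>R x \<le> y) \<longrightarrow> x \<le> 0)"
proof
  assume arch: "archimedean_ordered TYPE('a)"
  show "\<forall>x y :: 'a. (\<forall>n::nat. n \<ge> 1 \<longrightarrow> real n *\<^sub>R x \<le> y) \<longrightarrow> x \<le> 0"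
  proof (intro allI impI)
    fix x y :: 'a
    assume le: "\<forall>n::nat. n \<ge> 1 \<longrightarrow> real n *\<^sub>R x \<le> y"
    have "real n *\<^sub>R x \<le> sup y 0" for n :: nat
      using le by (cases "n = 0") (auto intro: le_supI1)
    then show "x \<le> 0"
      using arch by (auto simp: archimedean_ordered_def)
  qed
qed (auto simp: archimedean_ordered_def)

definition finite_dimensional :: "'a :: real_vector itself \<Rightarrow> bool" where
  "finite_dimensional _ \<longleftrightarrow>
     (\<exists>B :: 'a set. finite_dimensional_vector_space ((*\<^sub>R) :: real \<Rightarrow> 'a \<Rightarrow> 'a) B)"

end

theory Submission
  imports Defs "HOL-Library.Lattice_Algebras"
begin

text \<open>
  Let \<open>y\<close> be net catching and suppose that there are infinitely many pairwise disjoint positive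
  elements. Catching the net \<open>e / (n + 1)\<close> shows that \<open>y\<close> is an order unit, so these elements can
  be rescaled such that they lie below \<open>2y\<close>, but not below \<open>y\<close>. The set of all \<open>z \<ge> 0\<close> which
  dominate all but finitely many of them is directed downwards and has infimum \<open>0\<close>, yet none of
  its members is below \<open>y\<close>. Hence all families of pairwise disjoint positive elements are finite.
  Then a maximal disjoint family of atoms is finite and spans the space.

  Conversely, disjoint families are linearly independent and hence finite in finite dimension, so
  every positive element is a non-negative combination of finitely many disjoint atoms. A net that
  decreases to \<open>0\<close> eventually has all coordinates below \<open>1\<close>, so the sum of the atoms is net
  catching.
\<close>

section \<open>Disjoint elements of a vector lattice\<close>

text \<open>The sort only asks for \<open>ordered_real_vector\<close> and \<open>lattice\<close>, so
  the lattice group identities are drawn from a local interpretation of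
  \<open>lattice_ab_group_add\<close>.\<close>

lemma vl_add_inf_distrib_left:
  fixes a b c :: "'a :: {ordered_real_vector, lattice}"
  shows "a + inf b c = inf (a + b) (a + c)"
proof -
  interpret lattice_ab_group_add "(+)" "0 :: 'a" "(-)" uminus "(\<le>)" "(<)" inf sup
    by unfold_locales
  show ?thesis by (rule add_inf_distrib_left)
qed

lemma vl_add_eq_inf_sup:
  fixes a b :: "'a :: {ordered_real_vector, lattice}"
  shows "a + b = sup a b + inf a b"
proof -
  interpret lattice_ab_group_add "(+)" "0 :: 'a" "(-)" uminus "(\<le>)" "(<)" inf sup
    by unfold_locales
  show ?thesis by (rule add_eq_inf_sup)
qed

text \<open>Addition distributes over \<open>inf\<close>, so the right-hand side is the infimum of
  \<open>inf w a + u\<close> and \<open>inf w a + a\<close>; positivity puts the left-hand side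
  below both.\<close>

lemma inf_add_le:
  fixes u w a :: "'a :: {ordered_real_vector, lattice}"
  assumes "0 \<le> u" "0 \<le> w" "0 \<le> a"
  shows "inf (u + w) a \<le> inf u a + inf w a"
proof -
  have "inf (u + w) a \<le> u + a" "inf (u + w) a \<le> a + inf w a"
    using assms by (auto intro: le_infI2 add_increasing add_increasing2)
  then have "inf (u + w) a \<le> inf (inf w a + u) (inf w a + a)"
    by (simp add: vl_add_inf_distrib_left add.commute)
  then show ?thesis
    using vl_add_inf_distrib_left[of "inf w a" u a] by (simp add: add.commute)
qed

lemma disjoint_mono:
  fixes u w a b :: "'a :: {ordered_real_vector, lattice}"
  assumes "inf u a = 0" "0 \<le> w" "w \<le> u" "0 \<le> b" "b \<le> a"
  shows "inf w b = 0"
proof (rule antisym)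
  show "inf w b \<le> 0"
    using inf_mono[OF assms(3,5)] assms(1) by simp
qed (use assms in simp)

lemma disjoint_nonneg:
  fixes u a :: "'a :: {ordered_real_vector, lattice}"
  assumes "inf u a = 0"
  shows "0 \<le> u" "0 \<le> a"
  using assms by (metis inf_le1, metis inf_le2)

lemma disjoint_add:
  fixes u w a :: "'a :: {ordered_real_vector, lattice}"
  assumes "inf u a = 0" "inf w a = 0"
  shows "inf (u + w) a = 0"
proof (rule antisym)
  show "inf (u + w) a \<le> 0"
    using inf_add_le[of u w a] assms disjoint_nonneg[OF assms(1)] disjoint_nonneg[OF assms(2)]
    by simp
  show "0 \<le> inf (u + w) a"
    using disjoint_nonneg[OF assms(1)] disjoint_nonneg[OF assms(2)] by simp
qed

text \<open>Natural multiples follow from \<open>disjoint_add\<close> by induction, and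
  \<open>c\<close> lies below some natural number.\<close>

lemma disjoint_scale:
  fixes u a :: "'a :: {ordered_real_vector, lattice}"
  assumes "inf u a = 0" "0 \<le> c"
  shows "inf (c *\<^sub>R u) a = 0"
proof -
  note nn = disjoint_nonneg[OF assms(1)]
  have nat: "inf (real n *\<^sub>R u) a = 0" for n
    by (induction n) (use assms(1) nn in \<open>simp_all add: scaleR_left_distrib disjoint_add inf_absorb1\<close>)
  obtain n :: nat where "c \<le> real n"
    using real_arch_simple by blast
  then have "c *\<^sub>R u \<le> real n *\<^sub>R u"
    using nn by (intro scaleR_right_mono)
  show ?thesis
    using nat[of n]
    by (rule disjoint_mono) (use nn assms(2) \<open>c *\<^sub>R u \<le> real n *\<^sub>R u\<close> in \<open>auto simp: scaleR_nonneg_nonneg\<close>)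
qed

text \<open>The sum of disjoint elements is their supremum.\<close>

lemma disjoint_add_le:
  fixes u v z :: "'a :: {ordered_real_vector, lattice}"
  assumes "inf u v = 0" "u \<le> z" "v \<le> z"
  shows "u + v \<le> z"
  using vl_add_eq_inf_sup[of u v] assms by simp

lemma disjoint_diff_inf:
  fixes u v :: "'a :: {ordered_real_vector, lattice}"
  shows "inf (u - inf u v) (v - inf u v) = 0"
  using vl_add_inf_distrib_left[of "- inf u v" u v] by simp

lemma archimedean_orderedD:
  fixes x y :: "'a :: ordered_real_vector"
  assumes "archimedean_ordered TYPE('a)" "\<And>n. real n *\<^sub>R x \<le> y"
  shows "x \<le> 0"
  using assms unfolding archimedean_ordered_def by blast

definition disjoint_family :: "'a :: {ordered_real_vector, lattice} set \<Rightarrow> bool" where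
  "disjoint_family S \<longleftrightarrow> (\<forall>s\<in>S. 0 < s) \<and> pairwise (\<lambda>s t. inf s t = 0) S"

lemma disjoint_family_disjoint:
  "disjoint_family S \<Longrightarrow> s \<in> S \<Longrightarrow> t \<in> S \<Longrightarrow> s \<noteq> t \<Longrightarrow> inf s t = 0"
  by (auto simp: disjoint_family_def pairwise_def)

text \<open>Every \<open>v\<close> in the span of \<open>S - {a}\<close> is dominated, together with
  \<open>- v\<close>, by some \<open>w\<close> disjoint from \<open>a\<close>. If \<open>a\<close>
  itself were in that span, it would lie below an element disjoint from it and thus vanish.\<close>

lemma disjoint_family_independent:
  fixes S :: "'a :: {ordered_real_vector, lattice} set"
  assumes "disjoint_family S"
  shows "independent S"
proof
  assume "dependent S"
  then obtain a where a: "a \<in> S" "a \<in> span (S - {a})"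
    unfolding dependent_def by blast
  have "\<exists>w. inf w a = 0 \<and> v \<le> w \<and> - v \<le> w" if "v \<in> span (S - {a})" for v
    using that
  proof (induction rule: span_induct_alt)
    case base
    show ?case
      using assms a by (intro exI[of _ 0]) (auto simp: disjoint_family_def inf_absorb1 less_imp_le)
  next
    case (step c s v)
    then obtain w where w: "inf w a = 0" "v \<le> w" "- v \<le> w"
      by blast
    have s: "inf s a = 0"
      using step(1) a disjoint_family_disjoint[OF assms] by blast
    have "c *\<^sub>R s \<le> \<bar>c\<bar> *\<^sub>R s" "(- c) *\<^sub>R s \<le> \<bar>c\<bar> *\<^sub>R s"
      using disjoint_nonneg[OF s] by (intro scaleR_right_mono; simp)+
    then have "c *\<^sub>R s + v \<le> \<bar>c\<bar> *\<^sub>R s + w" "- (c *\<^sub>R s + v) \<le> \<bar>c\<bar> *\<^sub>R s + w"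
      using w(2,3) add_mono[of "- (c *\<^sub>R s)" "\<bar>c\<bar> *\<^sub>R s" "- v" w] by (auto intro: add_mono)
    then show ?case
      using disjoint_add[OF disjoint_scale[OF s, of "\<bar>c\<bar>"] w(1)] by auto
  qed
  then obtain w where "inf w a = 0" "a \<le> w"
    using a by blast
  then have "a = 0"
    by (simp add: inf_absorb2)
  then show False
    using assms a by (auto simp: disjoint_family_def)
qed

section \<open>Net catching elements\<close>

text \<open>By the Archimedean property the sequence \<open>e / (n + 1)\<close> decreases to
  \<open>0\<close>; a term caught below \<open>y\<close> gives the multiple.\<close>

lemma net_catching_order_unit:
  fixes y e :: "'a :: {ordered_real_vector, lattice}"
  assumes arch: "archimedean_ordered TYPE('a)" and y: "net_catching y" and e: "0 \<le> e"
  obtains n :: nat where "0 < n" "e \<le> real n *\<^sub>R y"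
proof -
  define x where "x n = inverse (real (Suc n)) *\<^sub>R e" for n
  have dec: "x n \<le> x m" if "m \<le> n" for m n
    unfolding x_def using that e by (intro scaleR_right_mono) (auto simp: field_simps)
  have glb: "w \<le> 0" if w: "\<And>n. w \<le> x n" for w
  proof (rule archimedean_orderedD[OF arch, of _ e])
    fix n
    show "real n *\<^sub>R w \<le> e"
    proof (cases n)
      case (Suc m)
      then show ?thesis
        using scaleR_left_mono[OF w[of m], of "real n"] by (simp add: x_def)
    qed (use e in simp)
  qed
  have "net_decreases_to_zero UNIV {(m, n :: nat). m \<le> n} x"
    unfolding net_decreases_to_zero_def directed_index_def
  proof (intro conjI)
    show "preorder_on UNIV {(m, n :: nat). m \<le> n}"
      by (auto simp: preorder_on_def refl_on_def trans_def)
    show "isGlb UNIV (range x) 0"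
      using glb e by (auto simp: isGlb_def greatestP_def isLb_def setge_def setle_def x_def scaleR_nonneg_nonneg)
  qed (use dec in \<open>auto intro: max.cobounded1 max.cobounded2\<close>)
  then obtain n where "x n \<le> y"
    using net_catching_any_index[OF y] by blast
  then have "real (Suc n) *\<^sub>R x n \<le> real (Suc n) *\<^sub>R y"
    by (intro scaleR_left_mono) auto
  then show ?thesis
    by (intro that[of "Suc n"]) (auto simp: x_def)
qed

text \<open>Subtracting \<open>v\<close> over and over without leaving \<open>D\<close> puts all
  multiples of \<open>v\<close> below one fixed member of \<open>D\<close>.\<close>

lemma nonpos_if_repeatedly_subtractable:
  fixes v :: "'a :: {ordered_real_vector, lattice}"
  assumes arch: "archimedean_ordered TYPE('a)" and "D \<noteq> {}"
    and nonneg: "\<And>z. z \<in> D \<Longrightarrow> 0 \<le> z"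
    and step: "\<And>z. z \<in> D \<Longrightarrow> \<exists>z'\<in>D. z' + v \<le> z"
  shows "v \<le> 0"
proof -
  have le: "real n *\<^sub>R v \<le> z" if "z \<in> D" for n z
    using that
  proof (induction n arbitrary: z)
    case 0
    then show ?case
      using nonneg by simp
  next
    case (Suc n)
    then obtain z' where z': "z' \<in> D" "z' + v \<le> z"
      using step by blast
    have "real (Suc n) *\<^sub>R v = real n *\<^sub>R v + v"
      by (simp add: scaleR_left_distrib)
    also have "\<dots> \<le> z' + v"
      using Suc.IH[OF z'(1)] by (rule add_right_mono)
    finally show ?case
      using z'(2) by (rule order_trans)
  qed
  obtain z where "z \<in> D"
    using \<open>D \<noteq> {}\<close> by blast
  then show ?thesis
    using archimedean_orderedD[OF arch] le by blast
qed

text \<open>Subtraction inside \<open>D\<close> is used twice for \<open>p = sup w 0\<close>. Taking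
  \<open>inf z e\<close> away from \<open>z\<close> can only spoil the bound at \<open>e\<close>,
  which makes \<open>p\<close> disjoint from every \<open>e\<close> in \<open>S\<close>. Then taking
  \<open>p\<close> away spoils no bound at all, so \<open>p\<close> vanishes.\<close>

lemma inf_almost_upper_bounds_eq_zero:
  fixes S :: "'a :: {ordered_real_vector, lattice} set"
  assumes arch: "archimedean_ordered TYPE('a)" and S: "disjoint_family S"
    and D_def: "D = {z. 0 \<le> z \<and> finite {s\<in>S. \<not> s \<le> z}}"
    and ne: "D \<noteq> {}" and w: "\<And>z. z \<in> D \<Longrightarrow> w \<le> z"
  shows "w \<le> 0"
proof -
  define p where "p = sup w 0"
  have p: "0 \<le> p" "\<And>z. z \<in> D \<Longrightarrow> p \<le> z"
    using w by (auto simp: p_def D_def)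
  have disj: "inf p e = 0" if e: "e \<in> S" for e
  proof (rule antisym)
    have e0: "0 \<le> e"
      using S e by (auto simp: disjoint_family_def)
    show "inf p e \<le> 0"
    proof (rule nonpos_if_repeatedly_subtractable[OF arch ne])
      fix z assume z: "z \<in> D"
      have "s \<le> z - inf z e" if s: "s \<in> S" "s \<noteq> e" "s \<le> z" for s
      proof -
        have "inf s (inf z e) = 0"
          using disjoint_family_disjoint[OF S s(1) e s(2)]
          by (rule disjoint_mono) (use z e0 S s in \<open>auto simp: D_def disjoint_family_def\<close>)
        then have "s + inf z e \<le> z"
          by (rule disjoint_add_le) (use s in auto)
        then show ?thesis
          by (simp add: le_diff_eq)
      qed
      then have "{s\<in>S. \<not> s \<le> z - inf z e} \<subseteq> insert e {s\<in>S. \<not> s \<le> z}"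
        by auto
      then have "z - inf z e \<in> D"
        using z unfolding D_def by (auto intro: finite_subset)
      \<comment> \<open>The amount removed is at least \<open>inf p e\<close>, because
        \<open>p\<close> is below \<open>z\<close>.\<close>
      moreover have "z - inf z e + inf p e \<le> z"
        using inf_mono[OF p(2)[OF z] order_refl[of e]] by (simp add: algebra_simps)
      ultimately show "\<exists>z'\<in>D. z' + inf p e \<le> z"
        by blast
    qed (simp add: D_def)
    show "0 \<le> inf p e"
      using p e0 by simp
  qed
  have "p \<le> 0"
  proof (rule nonpos_if_repeatedly_subtractable[OF arch ne])
    fix z assume z: "z \<in> D"
    have "s \<le> z - p" if "s \<in> S" "s \<le> z" for s
      using disjoint_add_le[OF disj[OF that(1)] p(2)[OF z] that(2)]
      by (simp add: le_diff_eq add.commute)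
    then have "{s\<in>S. \<not> s \<le> z - p} \<subseteq> {s\<in>S. \<not> s \<le> z}"
      by auto
    then have "z - p \<in> D"
      using z p(2)[OF z] unfolding D_def by (auto intro: finite_subset)
    then show "\<exists>z'\<in>D. z' + p \<le> z"
      by (intro bexI[of _ "z - p"]) auto
  qed (simp add: D_def)
  then show ?thesis
    by (simp add: p_def)
qed

text \<open>The almost upper bounds of \<open>S\<close>, directed downwards, form a net decreasing
  to \<open>0\<close>, and \<open>b\<close> is one of them. Whatever \<open>y\<close> catches passes
  its bounds on to \<open>y\<close>.\<close>

lemma net_catching_imp_le_almost_all:
  fixes S :: "'a :: {ordered_real_vector, lattice} set"
  assumes arch: "archimedean_ordered TYPE('a)" and y: "net_catching y"
    and S: "disjoint_family S" and b: "0 \<le> b" "\<And>s. s \<in> S \<Longrightarrow> s \<le> b"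
  shows "finite {s\<in>S. \<not> s \<le> y}"
proof -
  define D where "D = {z. 0 \<le> z \<and> finite {s\<in>S. \<not> s \<le> z}}"
  have "{s\<in>S. \<not> s \<le> b} = {}"
    using b by auto
  then have "finite {s\<in>S. \<not> s \<le> b}"
    by (simp only: finite.emptyI)
  then have ne: "D \<noteq> {}"
    using b(1) unfolding D_def by blast
  have dir: "inf u v \<in> D" if "u \<in> D" "v \<in> D" for u v
  proof -
    have "{s\<in>S. \<not> s \<le> inf u v} = {s\<in>S. \<not> s \<le> u} \<union> {s\<in>S. \<not> s \<le> v}"
      by auto
    with that show ?thesis
      by (simp add: D_def)
  qed
  have "net_decreases_to_zero D {(u, v). u \<in> D \<and> v \<in> D \<and> v \<le> u} (\<lambda>z. z)"
    unfolding net_decreases_to_zero_def directed_index_def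
  proof (intro conjI ballI)
    show "preorder_on D {(u, v). u \<in> D \<and> v \<in> D \<and> v \<le> u}"
      by (auto simp: preorder_on_def refl_on_def trans_def)
    show "isGlb UNIV ((\<lambda>z. z) ` D) 0"
      using inf_almost_upper_bounds_eq_zero[OF arch S D_def ne]
      by (auto simp: isGlb_def greatestP_def isLb_def setge_def setle_def D_def)
    fix u v assume "u \<in> D" "v \<in> D"
    then show "\<exists>c\<in>D. (u, c) \<in> {(u, v). u \<in> D \<and> v \<in> D \<and> v \<le> u} \<and>
                     (v, c) \<in> {(u, v). u \<in> D \<and> v \<in> D \<and> v \<le> u}"
      using dir by (intro bexI[of _ "inf u v"]) auto
  qed (use ne in auto)
  then obtain z where "z \<in> D" "z \<le> y"
    using net_catching_any_index[OF y] by blast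
  then show ?thesis
    unfolding D_def by (auto elim!: finite_subset[rotated] intro: order_trans)
qed

text \<open>The factor is \<open>n / m\<close>, where \<open>e\<close> is below \<open>m\<close>
  times \<open>y\<close> and \<open>n\<close> is the first number for which \<open>n\<close> times
  \<open>e\<close> is no longer below \<open>m\<close> times \<open>y\<close>.\<close>

lemma rescale_beyond_order_unit:
  fixes y e :: "'a :: {ordered_real_vector, lattice}"
  assumes arch: "archimedean_ordered TYPE('a)" and y: "net_catching y" and e: "0 < e"
  shows "\<exists>k>0. k *\<^sub>R e \<le> 2 *\<^sub>R y \<and> \<not> k *\<^sub>R e \<le> y"
proof -
  obtain m where m: "0 < m" "e \<le> real m *\<^sub>R y"
    using net_catching_order_unit[OF arch y] e less_imp_le by blast
  define P where "P n \<longleftrightarrow> \<not> real n *\<^sub>R e \<le> real m *\<^sub>R y" for n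
  have "\<exists>n. P n"
    using archimedean_orderedD[OF arch, of e] e unfolding P_def by (meson leD)
  then have n: "P (Least P)" and least: "\<And>i. i < Least P \<Longrightarrow> \<not> P i"
    by (auto intro: LeastI_ex dest: not_less_Least)
  define n where "n = Least P"
  have "0 \<le> real m *\<^sub>R y"
    using m(2) e by (meson less_imp_le order_trans)
  then have "\<not> P 0" "\<not> P 1"
    using m by (auto simp: P_def)
  then have "n \<noteq> 0" "n \<noteq> 1"
    using n unfolding n_def by metis+
  \<comment> \<open>This gives \<open>n \<le> 2 * (n - 1)\<close>, so minimality at
    \<open>n - 1\<close> bounds \<open>n\<close> times \<open>e\<close> by twice \<open>m\<close>
    times \<open>y\<close>.\<close>
  then have n2: "2 \<le> n"
    by linarith
  have "real n *\<^sub>R e \<le> real (2 * (n - 1)) *\<^sub>R e"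
    using e n2 by (intro scaleR_right_mono) auto
  also have "\<dots> = 2 *\<^sub>R (real (n - 1) *\<^sub>R e)"
    by simp
  also have "\<dots> \<le> 2 *\<^sub>R (real m *\<^sub>R y)"
    using least[of "n - 1"] n2 unfolding n_def P_def by (intro scaleR_left_mono) auto
  finally have "inverse (real m) *\<^sub>R (real n *\<^sub>R e) \<le> inverse (real m) *\<^sub>R (2 *\<^sub>R (real m *\<^sub>R y))"
    by (intro scaleR_left_mono) auto
  then have le: "(real n / real m) *\<^sub>R e \<le> 2 *\<^sub>R y"
    using m by (simp add: field_simps)
  have "\<not> (real n / real m) *\<^sub>R e \<le> y"
  proof
    assume "(real n / real m) *\<^sub>R e \<le> y"
    then have "real m *\<^sub>R ((real n / real m) *\<^sub>R e) \<le> real m *\<^sub>R y"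
      by (intro scaleR_left_mono) auto
    then show False
      using n m(1) by (simp add: P_def n_def)
  qed
  then show ?thesis
    using le n2 m by (intro exI[of _ "real n / real m"]) auto
qed

text \<open>After rescaling, the family is bounded by twice \<open>y\<close> while no member is
  below \<open>y\<close>; yet all but finitely many members must be.\<close>

lemma net_catching_imp_finite_disjoint_family:
  fixes y :: "'a :: {ordered_real_vector, lattice}" and S :: "'a set"
  assumes arch: "archimedean_ordered TYPE('a)" and y: "net_catching y"
    and S: "disjoint_family S"
  shows "finite S"
proof -
  have pos: "0 < s" if "s \<in> S" for s
    using S that by (auto simp: disjoint_family_def)
  then obtain k where k: "\<And>s. s \<in> S \<Longrightarrow> 0 < k s \<and> k s *\<^sub>R s \<le> 2 *\<^sub>R y \<and> \<not> k s *\<^sub>R s \<le> y"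
    using rescale_beyond_order_unit[OF arch y] by metis
  define f where "f s = k s *\<^sub>R s" for s
  have fpos: "0 < f s" if "s \<in> S" for s
    using k[OF that] pos[OF that] unfolding f_def
    by (metis less_le scaleR_eq_0_iff scaleR_nonneg_nonneg)
  have disj: "inf (f s) (f t) = 0" if "s \<in> S" "t \<in> S" "s \<noteq> t" for s t
  proof -
    have "inf s (f t) = 0"
      using disjoint_scale[of t s "k t"] disjoint_family_disjoint[OF S that] k[OF that(2)]
      by (simp add: f_def inf_commute)
    then show ?thesis
      using disjoint_scale[of s "f t" "k s"] k[OF that(1)] by (simp add: f_def)
  qed
  \<comment> \<open>A common value of \<open>f\<close> at distinct points would be positive and
    disjoint from itself.\<close>
  have inj: "inj_on f S"
  proof
    fix s t assume "s \<in> S" "t \<in> S" "f s = f t"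
    then show "s = t"
      using disj[of s t] fpos[of s] by force
  qed
  have "disjoint_family (f ` S)"
    using fpos disj by (auto simp: disjoint_family_def pairwise_def)
  \<comment> \<open>The order unit property at the element \<open>0\<close> shows that
    \<open>y\<close> is positive.\<close>
  moreover obtain n where "0 < n" "0 \<le> real n *\<^sub>R y"
    using net_catching_order_unit[OF arch y order_refl] .
  then have "0 \<le> 2 *\<^sub>R y"
    by (simp add: zero_le_scaleR_iff)
  ultimately have "finite {s\<in>f ` S. \<not> s \<le> y}"
    by (rule net_catching_imp_le_almost_all[OF arch y]) (use k in \<open>auto simp: f_def\<close>)
  moreover have "{s\<in>f ` S. \<not> s \<le> y} = f ` S"
    using k by (auto simp: f_def)
  ultimately show ?thesis
    using finite_imageD inj by auto
qed

section \<open>Spaces in which disjoint families are finite\<close>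

text \<open>The condition \<open>inf u v = 0\<close> already forces \<open>u\<close> and
  \<open>v\<close> to be non-negative. In the Archimedean case this is the usual notion: the
  elements between \<open>0\<close> and \<open>a\<close> are exactly the multiples of
  \<open>a\<close> by scalars in the unit interval.\<close>

definition atom :: "'a :: {ordered_real_vector, lattice} \<Rightarrow> bool" where
  "atom a \<longleftrightarrow> 0 < a \<and> (\<forall>u v. u \<le> a \<longrightarrow> v \<le> a \<longrightarrow> inf u v = 0 \<longrightarrow> u = 0 \<or> v = 0)"

text \<open>Without atoms below \<open>e\<close>, splitting into two disjoint pieces never ends, and
  this produces an infinite disjoint family.\<close>

lemma atom_below:
  fixes e :: "'a :: {ordered_real_vector, lattice}"
  assumes fin: "\<And>S :: 'a set. disjoint_family S \<Longrightarrow> finite S" and e: "0 < e"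
  obtains a where "atom a" "a \<le> e"
proof (rule ccontr)
  assume "\<not> thesis"
  with that have "\<not> atom g" if "g \<le> e" for g
    using that by blast
  then have "\<exists>u v. 0 < u \<and> 0 < v \<and> u \<le> g \<and> v \<le> g \<and> inf u v = 0" if "0 < g" "g \<le> e" for g
    using that unfolding atom_def by (metis disjoint_nonneg less_le)
  then obtain F G where FG:
    "\<And>g. 0 < g \<Longrightarrow> g \<le> e \<Longrightarrow> 0 < F g \<and> 0 < G g \<and> F g \<le> g \<and> G g \<le> g \<and> inf (F g) (G g) = 0"
    by metis
  \<comment> \<open>The piece \<open>G\<close> is split further and the piece \<open>F\<close> is
    kept: \<open>f n\<close> is disjoint from \<open>g (Suc n)\<close>, which dominates all later
    \<open>f\<close>.\<close>
  define g where "g n = (G ^^ n) e" for n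
  have g: "0 < g n \<and> g n \<le> e" for n
  proof (induction n)
    case (Suc n)
    then show ?case
      using FG[of "g n"] by (auto simp: g_def intro: order_trans)
  qed (use e in \<open>simp add: g_def\<close>)
  have Suc_le: "g (Suc n) \<le> g n" for n
    using FG[of "g n"] g[of n] by (simp add: g_def)
  have dec: "g n \<le> g m" if "m \<le> n" for m n
    using lift_Suc_antimono_le[of g, OF Suc_le that] .
  define f where "f n = F (g n)" for n
  have f: "0 < f n" "f n \<le> g n" "inf (f n) (g (Suc n)) = 0" for n
    using FG[of "g n"] g[of n] by (auto simp: f_def g_def)
  have lt: "inf (f m) (f n) = 0" if "m < n" for m n
    using f(3)[of m]
    by (rule disjoint_mono)
      (use f(1)[of n] f(1)[of m] order_trans[OF f(2)[of n] dec[of "Suc m" n]] that in auto)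
  then have disj: "inf (f m) (f n) = 0" if "m \<noteq> n" for m n
    using that by (metis inf_commute linorder_neqE_nat)
  then have "disjoint_family (range f)"
    using f(1) by (auto simp: disjoint_family_def pairwise_def intro!: disj)
  moreover have "inj f"
    using disj f(1) by (metis injI inf.idem less_irrefl)
  ultimately show False
    using fin finite_imageD[of f UNIV] by auto
qed

text \<open>It suffices to bound \<open>inf r a\<close> by every positive multiple of
  \<open>a\<close>. Removing the common part of \<open>r\<close> and
  \<open>\<epsilon> *\<^sub>R a\<close> leaves disjoint remainders, and an atom must be disjoint
  from one of them.\<close>

lemma disjoint_from_atom:
  fixes a r :: "'a :: {ordered_real_vector, lattice}"
  assumes arch: "archimedean_ordered TYPE('a)" and a: "atom a" and r: "0 \<le> r"
    and no: "\<And>\<epsilon>. \<epsilon> > 0 \<Longrightarrow> \<not> \<epsilon> *\<^sub>R a \<le> r"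
  shows "inf r a = 0"
proof (rule antisym)
  have a0: "0 < a"
    using a by (simp add: atom_def)
  have small: "inf r a \<le> \<epsilon> *\<^sub>R a" if \<epsilon>: "\<epsilon> > 0" for \<epsilon>
  proof -
    define m where "m = inf r (\<epsilon> *\<^sub>R a)"
    define u v where "u = r - m" and "v = \<epsilon> *\<^sub>R a - m"
    have uv: "inf u v = 0"
      unfolding u_def v_def m_def by (rule disjoint_diff_inf)
    have m0: "0 \<le> m"
      using r a0 \<epsilon> by (simp add: m_def scaleR_nonneg_nonneg)
    have uv0: "0 \<le> u" "0 \<le> v" "u \<le> r" "v \<le> \<epsilon> *\<^sub>R a"
      using m0 by (auto simp: u_def v_def m_def)
    \<comment> \<open>Truncation at \<open>a\<close> brings both remainders below the atom.\<close>
    have "inf (inf u a) (inf v a) = 0"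
      using uv by (rule disjoint_mono) (use uv0 a0 in auto)
    then consider "inf u a = 0" | "inf v a = 0"
      using a unfolding atom_def by (meson inf_le2)
    then show ?thesis
    proof cases
      case 1
      have "inf r a = inf (u + m) a"
        by (simp add: u_def)
      also have "\<dots> \<le> inf u a + inf m a"
        using uv0 m0 a0 by (intro inf_add_le) auto
      also have "\<dots> \<le> \<epsilon> *\<^sub>R a"
        using 1 by (simp add: m_def le_infI1)
      finally show ?thesis .
    next
      case 2
      \<comment> \<open>Here \<open>v\<close> lies below \<open>\<epsilon> *\<^sub>R a\<close> and
        is disjoint from it, so it vanishes, against the assumption \<open>no\<close>.\<close>
      then have "inf (\<epsilon> *\<^sub>R a) v = 0"
        using disjoint_scale[of a v \<epsilon>] \<epsilon> by (simp add: inf_commute)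
      then have "v = 0"
        using uv0 by (simp add: inf_absorb2)
      then have "\<epsilon> *\<^sub>R a \<le> r"
        by (simp add: v_def m_def le_iff_inf inf_commute)
      then show ?thesis
        using no[OF \<epsilon>] by blast
    qed
  qed
  show "inf r a \<le> 0"
  proof (rule archimedean_orderedD[OF arch, of _ a])
    fix n
    show "real n *\<^sub>R inf r a \<le> a"
    proof (cases "n = 0")
      case False
      then show ?thesis
        using scaleR_left_mono[OF small[of "inverse (real n)"], of "real n"] by simp
    qed (use a0 in simp)
  qed
  show "0 \<le> inf r a"
    using r a0 by simp
qed

text \<open>The coordinate \<open>t\<close> is the largest scalar with \<open>t *\<^sub>R a\<close>
  below \<open>x\<close>; by maximality the remainder dominates no positive multiple of
  \<open>a\<close>.\<close>

lemma atom_projection: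
  fixes a x :: "'a :: {ordered_real_vector, lattice}"
  assumes arch: "archimedean_ordered TYPE('a)" and a: "atom a" and x: "0 \<le> x"
  obtains t where "0 \<le> t" "t *\<^sub>R a \<le> x" "inf (x - t *\<^sub>R a) a = 0"
proof -
  have a0: "0 < a"
    using a by (simp add: atom_def)
  define T where "T = {s. s *\<^sub>R a \<le> x}"
  have "0 \<in> T"
    using x by (simp add: T_def)
  obtain n :: nat where n: "\<not> real n *\<^sub>R a \<le> x"
    using archimedean_orderedD[OF arch, of a x] a0 by (meson leD)
  have "s \<le> real n" if "s \<in> T" for s
  proof (rule ccontr)
    assume "\<not> s \<le> real n"
    then have "real n *\<^sub>R a \<le> s *\<^sub>R a"
      using a0 by (intro scaleR_right_mono) auto
    then show False
      using n that unfolding T_def by (auto intro: order_trans)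
  qed
  then have bdd: "bdd_above T"
    by (auto simp: bdd_above_def)
  define t where "t = Sup T"
  have t0: "0 \<le> t"
    unfolding t_def by (rule cSup_upper[OF \<open>0 \<in> T\<close> bdd])
  \<comment> \<open>The supremum is attained: a member of \<open>T\<close> beyond
    \<open>t - 1/n\<close> bounds the difference by \<open>a / n\<close>, for every positive
    \<open>n\<close>.\<close>
  have "t *\<^sub>R a - x \<le> 0"
  proof (rule archimedean_orderedD[OF arch, of _ a])
    fix n
    show "real n *\<^sub>R (t *\<^sub>R a - x) \<le> a"
    proof (cases "n = 0")
      case False
      then have "t - inverse (real n) < Sup T"
        by (simp add: t_def)
      then obtain s where s: "s \<in> T" "t - inverse (real n) < s"
        using less_cSup_iff[OF _ bdd] \<open>0 \<in> T\<close> by blast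
      have "(t - inverse (real n)) *\<^sub>R a \<le> s *\<^sub>R a"
        using s(2) a0 by (intro scaleR_right_mono) auto
      also have "\<dots> \<le> x"
        using s(1) by (simp add: T_def)
      finally have "t *\<^sub>R a - x \<le> inverse (real n) *\<^sub>R a"
        by (simp add: algebra_simps)
      then have "real n *\<^sub>R (t *\<^sub>R a - x) \<le> real n *\<^sub>R (inverse (real n) *\<^sub>R a)"
        by (intro scaleR_left_mono) auto
      then show ?thesis
        using False by simp
    qed (use a0 in simp)
  qed
  then have tx: "t *\<^sub>R a \<le> x"
    by simp
  have "inf (x - t *\<^sub>R a) a = 0"
  proof (rule disjoint_from_atom[OF arch a])
    fix \<epsilon> :: real assume \<epsilon>: "\<epsilon> > 0"
    show "\<not> \<epsilon> *\<^sub>R a \<le> x - t *\<^sub>R a"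
    proof
      assume "\<epsilon> *\<^sub>R a \<le> x - t *\<^sub>R a"
      then have "t + \<epsilon> \<in> T"
        by (simp add: T_def algebra_simps)
      then show False
        using cSup_upper[OF _ bdd] \<epsilon> unfolding t_def by fastforce
    qed
  qed (use tx in simp)
  then show ?thesis
    using that t0 tx by blast
qed

text \<open>Atoms are split off one at a time; the remainder only shrinks, so it stays disjoint from
  the atoms treated before.\<close>

lemma atoms_decomposition:
  fixes A :: "'a :: {ordered_real_vector, lattice} set"
  assumes arch: "archimedean_ordered TYPE('a)" and "finite A" "\<And>a. a \<in> A \<Longrightarrow> atom a" "0 \<le> x"
  shows "\<exists>t r. (\<forall>a. 0 \<le> t a) \<and> x = (\<Sum>a\<in>A. t a *\<^sub>R a) + r \<and> 0 \<le> r \<and> (\<forall>a\<in>A. inf r a = 0)"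
  using assms(2,3)
proof (induction A)
  case empty
  show ?case
    using \<open>0 \<le> x\<close> by (intro exI[of _ "\<lambda>_. 0"] exI[of _ x]) simp
next
  case (insert b A)
  then obtain t r where tr: "\<forall>a. 0 \<le> t a" "x = (\<Sum>a\<in>A. t a *\<^sub>R a) + r" "0 \<le> r"
      "\<forall>a\<in>A. inf r a = 0"
    by auto
  obtain c where c: "0 \<le> c" "c *\<^sub>R b \<le> r" "inf (r - c *\<^sub>R b) b = 0"
    using atom_projection[OF arch _ tr(3), of b] insert.prems by blast
  have "0 \<le> c *\<^sub>R b"
    using c(1) disjoint_nonneg[OF c(3)] by (simp add: scaleR_nonneg_nonneg)
  then have "inf (r - c *\<^sub>R b) a = 0" if "a \<in> A" for a
    using disjoint_mono[of r a "r - c *\<^sub>R b" a] disjoint_nonneg[of r a] tr(4) that c(2) by simp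
  moreover have "(\<Sum>a\<in>A. (t(b := c)) a *\<^sub>R a) = (\<Sum>a\<in>A. t a *\<^sub>R a)"
    by (rule sum.cong) (use insert.hyps in auto)
  then have "(\<Sum>a\<in>insert b A. (t(b := c)) a *\<^sub>R a) = c *\<^sub>R b + (\<Sum>a\<in>A. t a *\<^sub>R a)"
    using insert.hyps by (simp del: fun_upd_apply add: fun_upd_same)
  ultimately show ?case
    using tr c by (intro exI[of _ "t(b := c)"] exI[of _ "r - c *\<^sub>R b"]) auto
qed

text \<open>Zorn's lemma yields a maximal disjoint family of atoms. A nonzero remainder would
  dominate a further atom disjoint from all of them.\<close>

lemma spanned_by_finitely_many_atoms:
  assumes arch: "archimedean_ordered TYPE('a :: {ordered_real_vector, lattice})"
    and fin: "\<And>S :: 'a :: {ordered_real_vector, lattice} set. disjoint_family S \<Longrightarrow> finite S"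
  obtains A :: "'a :: {ordered_real_vector, lattice} set" where "finite A" "\<And>a. a \<in> A \<Longrightarrow> 0 < a"
    "\<And>x. 0 \<le> x \<Longrightarrow> \<exists>t. (\<forall>a. 0 \<le> t a) \<and> x = (\<Sum>a\<in>A. t a *\<^sub>R a)"
proof -
  define \<A> :: "'a set set" where "\<A> = {S. disjoint_family S \<and> (\<forall>a\<in>S. atom a)}"
  have "\<exists>A\<in>\<A>. \<forall>S\<in>\<A>. A \<subseteq> S \<longrightarrow> S = A"
  proof (rule subset_Zorn')
    fix C assume C: "subset.chain \<A> C"
    have "pairwise (\<lambda>s t. inf s t = 0) (\<Union>C)"
      using C by (intro pairwise_chain_Union)
        (auto simp: subset_chain_def chain_subset_def \<A>_def disjoint_family_def)
    then show "\<Union>C \<in> \<A>"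
      using C by (auto simp: subset_chain_def \<A>_def disjoint_family_def)
  qed
  then obtain A where A: "A \<in> \<A>" and max: "\<And>S. S \<in> \<A> \<Longrightarrow> A \<subseteq> S \<Longrightarrow> S = A"
    by blast
  have df: "disjoint_family A" and at: "\<And>a. a \<in> A \<Longrightarrow> atom a"
    using A by (auto simp: \<A>_def)
  have "\<exists>t. (\<forall>a. 0 \<le> t a) \<and> x = (\<Sum>a\<in>A. t a *\<^sub>R a)" if "0 \<le> x" for x
  proof -
    obtain t r where tr: "\<forall>a. 0 \<le> t a" "x = (\<Sum>a\<in>A. t a *\<^sub>R a) + r" "0 \<le> r"
        "\<forall>a\<in>A. inf r a = 0"
      using atoms_decomposition[OF arch fin[OF df] at \<open>0 \<le> x\<close>] by blast
    have "r = 0"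
    proof (rule ccontr)
      assume "r \<noteq> 0"
      then have "0 < r"
        using tr(3) by simp
      then obtain c where c: "atom c" "c \<le> r"
        using atom_below[OF fin] by blast
      then have c0: "0 < c"
        by (simp add: atom_def)
      have disj: "inf c a = 0" if "a \<in> A" for a
        using disjoint_mono[of r a c a] disjoint_nonneg[of r a] tr(4) that c(2) c0 by simp
      then have "disjoint_family (insert c A)"
        using df c0 by (simp add: disjoint_family_def pairwise_insert inf_commute)
      then have "insert c A \<in> \<A>"
        using at c(1) by (simp add: \<A>_def)
      then have "c \<in> A"
        using max by blast
      then show False
        using disj[of c] c0 by simp
    qed
    then show ?thesis
      using tr by auto
  qed
  then show ?thesis
    using that[OF fin[OF df]] at by (auto simp: atom_def)
qed

section \<open>Finite dimension\<close>

lemma finite_dimensionalI: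
  fixes A :: "'a :: real_vector set"
  assumes "finite A" "span A = UNIV"
  shows "finite_dimensional TYPE('a)"
proof -
  obtain B where B: "B \<subseteq> A" "independent B" "A \<subseteq> span B"
    using maximal_independent_subset by blast
  then have "span B = UNIV"
    using assms(2) span_mono[OF B(3)] by (auto simp: span_span)
  then have "finite_dimensional_vector_space ((*\<^sub>R) :: real \<Rightarrow> 'a \<Rightarrow> 'a) B"
    using B finite_subset[OF B(1) assms(1)]
    by unfold_locales (auto simp: dependent_raw_def span_raw_def)
  then show ?thesis
    unfolding finite_dimensional_def by blast
qed

lemma finite_dimensional_imp_finite_independent:
  fixes S :: "'a :: real_vector set"
  assumes "finite_dimensional TYPE('a)" "independent S"
  shows "finite S"
proof -
  obtain B where "finite_dimensional_vector_space ((*\<^sub>R) :: real \<Rightarrow> 'a \<Rightarrow> 'a) B"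
    using assms(1) unfolding finite_dimensional_def by blast
  then show ?thesis
    using finite_dimensional_vector_space.finiteI_independent assms(2)
    unfolding dependent_raw_def by blast
qed

lemma net_catching_imp_finite_dimensional:
  fixes y :: "'a :: {ordered_real_vector, lattice}"
  assumes arch: "archimedean_ordered TYPE('a)" and y: "net_catching y"
  shows "finite_dimensional TYPE('a)"
proof -
  obtain A :: "'a set" where A: "finite A" "\<And>a. a \<in> A \<Longrightarrow> 0 < a"
    "\<And>x. 0 \<le> x \<Longrightarrow> \<exists>t. (\<forall>a. 0 \<le> t a) \<and> x = (\<Sum>a\<in>A. t a *\<^sub>R a)"
    using spanned_by_finitely_many_atoms[OF arch net_catching_imp_finite_disjoint_family[OF arch y]]
    by metis
  have pos: "x \<in> span A" if "0 \<le> x" for x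
  proof -
    obtain t where "x = (\<Sum>a\<in>A. t a *\<^sub>R a)"
      using A(3)[OF \<open>0 \<le> x\<close>] by blast
    also have "\<dots> \<in> span A"
      by (intro span_sum span_scale span_base)
    finally show ?thesis .
  qed
  have "x \<in> span A" for x
  proof -
    \<comment> \<open>Every element is a difference of two positive ones.\<close>
    have "sup x 0 - (sup x 0 - x) \<in> span A"
      by (intro span_diff pos) auto
    then show ?thesis
      by simp
  qed
  then show ?thesis
    using finite_dimensionalI[OF A(1)] by blast
qed

text \<open>No single \<open>a\<close> is a lower bound of the net, since the infimum is
  \<open>0\<close>; directedness and monotonicity combine the finitely many indices into
  one.\<close>

lemma net_decreases_to_zero_eventually_not_above:
  assumes net: "net_decreases_to_zero I r x" and "finite A" "\<And>a. a \<in> A \<Longrightarrow> \<not> a \<le> 0"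
  shows "\<exists>i\<in>I. \<forall>a\<in>A. \<not> a \<le> x i"
  using assms(2,3)
proof (induction A)
  case empty
  then show ?case
    using net by (auto simp: net_decreases_to_zero_def directed_index_def)
next
  case (insert b A)
  then obtain i where i: "i \<in> I" "\<forall>a\<in>A. \<not> a \<le> x i"
    by auto
  have "b \<le> 0" if "\<forall>j\<in>I. b \<le> x j"
    using net that
    by (auto simp: net_decreases_to_zero_def isGlb_def greatestP_def isLb_def setge_def setle_def)
  then obtain j where j: "j \<in> I" "\<not> b \<le> x j"
    using insert.prems by auto
  obtain k where k: "k \<in> I" "(i, k) \<in> r" "(j, k) \<in> r"
    using net i(1) j(1) unfolding net_decreases_to_zero_def directed_index_def by blast
  then have "x k \<le> x i" "x k \<le> x j"
    using net by (auto simp: net_decreases_to_zero_def)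
  then show ?case
    using i(2) j(2) k(1) by (blast intro: order_trans)
qed

text \<open>Disjoint families are independent, hence finite, so finitely many positive elements
  generate the positive cone. Their sum catches a net as soon as the net dominates none of
  them.\<close>

lemma finite_dimensional_imp_net_catching:
  assumes arch: "archimedean_ordered TYPE('a :: {ordered_real_vector, lattice})"
    and fd: "finite_dimensional TYPE('a :: {ordered_real_vector, lattice})"
  shows "\<exists>y :: 'a :: {ordered_real_vector, lattice}. net_catching y"
proof -
  obtain A :: "'a set" where A: "finite A" "\<And>a. a \<in> A \<Longrightarrow> 0 < a"
    "\<And>x. 0 \<le> x \<Longrightarrow> \<exists>t. (\<forall>a. 0 \<le> t a) \<and> x = (\<Sum>a\<in>A. t a *\<^sub>R a)"
    using spanned_by_finitely_many_atoms[OF arch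
        finite_dimensional_imp_finite_independent[OF fd disjoint_family_independent]]
    by metis
  have "net_catching (\<Sum>A)"
    unfolding net_catching_def
  proof (intro allI impI)
    fix I :: "'a set" and r and x :: "'a \<Rightarrow> 'a"
    assume net: "net_decreases_to_zero I r x"
    then obtain i where i: "i \<in> I" "\<forall>a\<in>A. \<not> a \<le> x i"
      using net_decreases_to_zero_eventually_not_above[OF net A(1)] A(2) by (meson leD)
    have "0 \<le> x i"
      using net i(1)
      by (auto simp: net_decreases_to_zero_def isGlb_def greatestP_def isLb_def setge_def)
    then obtain t where t: "\<forall>a. 0 \<le> t a" "x i = (\<Sum>a\<in>A. t a *\<^sub>R a)"
      using A(3) by blast
    have nonneg: "0 \<le> t a *\<^sub>R a" if "a \<in> A" for a
      using t(1) A(2)[OF that] by (simp add: scaleR_nonneg_nonneg less_imp_le)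
    have "t a *\<^sub>R a \<le> a" if a: "a \<in> A" for a
    proof -
      \<comment> \<open>The other summands are non-negative, so a coefficient of at least
        \<open>1\<close> would put \<open>a\<close> below \<open>x i\<close>.\<close>
      have "t a < 1"
      proof (rule ccontr)
        assume "\<not> t a < 1"
        then have "1 *\<^sub>R a \<le> t a *\<^sub>R a"
          using A(2)[OF a] by (intro scaleR_right_mono) auto
        also have "\<dots> \<le> x i"
          unfolding t(2) sum.remove[OF A(1) a]
          by (intro add_increasing2 sum_nonneg order_refl) (use nonneg in auto)
        finally show False
          using i(2) a by simp
      qed
      then show ?thesis
        using scaleR_right_mono[of "t a" 1 a] A(2)[OF a] by simp
    qed
    then have "x i \<le> \<Sum>A"
      unfolding t(2) by (rule sum_mono)
    then show "\<exists>i\<in>I. x i \<le> \<Sum>A"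
      using i(1) by blast
  qed
  then show ?thesis
    by blast
qed

theorem theorem6p5:
  assumes "archimedean_ordered TYPE('a :: {ordered_real_vector, lattice})"
  shows "(\<exists>y :: 'a. net_catching y) \<longleftrightarrow> finite_dimensional TYPE('a)"
  using net_catching_imp_finite_dimensional[OF assms] finite_dimensional_imp_net_catching[OF assms]
  by blast

end
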